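(* Let $n\ge1$. The problem of maximizing the algebraic root margin $$m(\bm r)=\min_{\bm\alpha\in\Sigma_+}\bm\alpha(\bm r)$$ over $\bm r\in\overline{\mathcal C}=\{\bm r\in\mathbb R^n: r_1\ge r_2\ge\cdots\ge r_n\ge0\}$ subject to $\lVert\bm r\rVert=1$ (Euclidean norm) has a unique maximizer, namely the normalized dual Weyl vector $$\bm r^\star=\frac{\bm\rho^\vee}{\lVert\bm\rho^\vee\rVert},\qquad \bm\rho^\vee=\tfrac12(2n-1,2n-3,\dots,3,1).$$
   Context: $\Sigma_+=\{2\bm e_j\}_{j=1}^n\cup\{\bm e_j-\bm e_k,\ \bm e_j+\bm e_k\}_{1\le j<k\le n}$ is the set of positive roots of type $C_n$, regarded as linear forms on $\mathbb R^n$ with $\bm e_j(\bm r)=r_j$. The Euclidean normalization is $|2\bm e_j|^2=4$, $|\bm e_j\pm\bm e_k|^2=2$. The vector $\bm\rho^\vee$ is the half-sum of the positive coroots $\bm\alpha^\vee=2\bm\alpha/|\bm\alpha|^2$, $\bm\alpha\in\Sigma_+$. *)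

theory Defs
  imports "HOL-Analysis.Analysis"
begin

text \<open>
  The coordinates of \<open>\<real>\<^sup>n\<close> are indexed by an arbitrary finite linear order \<open>'n\<close>, \<open>n = CARD('n) \<ge> 1\<close>,
  whose elements, listed in increasing order, play the role of \<open>1, \<dots>, n\<close>. A root, being a vector,
  acts as a linear form through the inner product, so that \<open>axis j 1 \<bullet> r = r $ j\<close>.
\<close>

definition pos_roots_C :: "(real ^ 'n::{finite,linorder}) set" where
  "pos_roots_C =
     {2 *\<^sub>R axis j 1 |j. True} \<union>
     {axis j 1 - axis k 1 |j k. j < k} \<union>
     {axis j 1 + axis k 1 |j k. j < k}"

definition coroot :: "'a::real_inner \<Rightarrow> 'a" where
  "coroot \<alpha> = (2 / (norm \<alpha>)\<^sup>2) *\<^sub>R \<alpha>"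

definition dual_weyl_vector_C :: "real ^ 'n::{finite,linorder}" where
  "dual_weyl_vector_C = (1/2) *\<^sub>R (\<Sum>\<alpha>\<in>pos_roots_C. coroot \<alpha>)"

definition root_margin :: "real ^ 'n::{finite,linorder} \<Rightarrow> real" where
  "root_margin r = Min ((\<lambda>\<alpha>. \<alpha> \<bullet> r) ` pos_roots_C)"

definition closed_chamber_C :: "(real ^ 'n::{finite,linorder}) set" where
  "closed_chamber_C = {r. (\<forall>j k. j \<le> k \<longrightarrow> r $ k \<le> r $ j) \<and> (\<forall>j. 0 \<le> r $ j)}"

text \<open>The 1-based position of an index in the linear order.\<close>

definition index_pos :: "'n::{finite,linorder} \<Rightarrow> nat" where
  "index_pos j = card {..j}"

text \<open>\<open>Min\<close> and \<open>\<Sum>\<close> over the positive roots are only meaningful because of the next two facts.\<close>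

lemma finite_pos_roots_C: "finite pos_roots_C"
proof (rule finite_subset)
  show "pos_roots_C \<subseteq> range (\<lambda>j. 2 *\<^sub>R axis j 1) \<union>
      (\<lambda>(j, k). axis j 1 - axis k 1) ` UNIV \<union> (\<lambda>(j, k). axis j 1 + axis k 1) ` UNIV"
    unfolding pos_roots_C_def by auto
qed simp

lemma pos_roots_C_nonempty: "pos_roots_C \<noteq> {}"
  unfolding pos_roots_C_def by blast

end

theory Submission
  imports Defs
begin

text \<open>
  Half the sum of the positive coroots has \<open>j\<close>-th coordinate \<open>d\<^sub>j + 1/2\<close>, where \<open>d\<^sub>j\<close> is the number
  of indices after \<open>j\<close>, and every positive root takes a value \<open>\<ge> 1\<close> on it. Conversely,
  descending from the last coordinate along the simple roots, any \<open>r\<close> of margin \<open>\<ge> c\<close> dominates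
  \<open>c \<cdot> \<rho>\<close> coordinatewise. For \<open>c = 1 / \<parallel>\<rho>\<parallel>\<close> and \<open>\<parallel>r\<parallel> = 1\<close> both vectors have the same norm, and
  domination between nonnegative vectors of equal norm is equality. So every unit vector whose margin
  is at least that of \<open>\<rho> / \<parallel>\<rho>\<parallel>\<close> is \<open>\<rho> / \<parallel>\<rho>\<parallel>\<close> itself.
\<close>

lemma index_pos_add_card_greaterThan:
  fixes j :: "'n::{finite,linorder}"
  shows "index_pos j + card {j<..} = CARD('n)"
proof -
  have "card ({..j} \<union> {j<..}) = card {..j} + card {j<..}"
    by (rule card_Un_disjoint) auto
  moreover have "{..j} \<union> {j<..} = UNIV" by auto
  ultimately show ?thesis by (simp add: index_pos_def)
qed

lemma norm_axis_diff_sum_sq: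
  fixes j k :: "'n::finite"
  assumes "j \<noteq> k"
  shows "(norm (axis j 1 - axis k 1 :: real ^ 'n))\<^sup>2 = 2"
    and "(norm (axis j 1 + axis k 1 :: real ^ 'n))\<^sup>2 = 2"
  using assms by (simp_all add: power2_norm_eq_inner inner_diff_left inner_diff_right
      inner_add_left inner_add_right inner_axis_axis)

lemma coroot_long_C: "coroot (2 *\<^sub>R axis j 1 :: real ^ 'n::finite) = axis j 1"
  by (simp add: coroot_def)

lemma coroot_short_C:
  fixes j k :: "'n::finite"
  assumes "j \<noteq> k"
  shows "coroot (axis j 1 - axis k 1 :: real ^ 'n) = axis j 1 - axis k 1"
    and "coroot (axis j 1 + axis k 1 :: real ^ 'n) = axis j 1 + axis k 1"
  using norm_axis_diff_sum_sq[OF assms] by (simp_all add: coroot_def)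

lemma inj_on_axis_diff:
  "inj_on (\<lambda>(j, k). axis j 1 - axis k 1 :: real ^ 'n::{finite,linorder}) {(j, k). j < k}"
proof (rule inj_onI, clarsimp)
  fix j k j' k' :: 'n
  assume lt: "j < k" "j' < k'"
    and eq: "(axis j 1 - axis k 1 :: real ^ 'n::{finite,linorder}) = axis j' 1 - axis k' 1"
  have "(axis j 1 - axis k 1 :: real ^ 'n::{finite,linorder}) $ i = (axis j' 1 - axis k' 1 :: real ^ 'n::{finite,linorder}) $ i" for i
    using eq by simp
  from this[of j] this[of k] show "j = j' \<and> k = k'"
    using lt by (auto simp: axis_def split: if_splits)
qed

text \<open>Reading off coordinates \<open>j\<close> and \<open>k\<close> recovers the set of the
  two indices, and the order \<open>j < k\<close> then recovers the pair.\<close>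

lemma inj_on_axis_add:
  "inj_on (\<lambda>(j, k). axis j 1 + axis k 1 :: real ^ 'n::{finite,linorder}) {(j, k). j < k}"
proof (rule inj_onI, clarsimp)
  fix j k j' k' :: 'n
  assume lt: "j < k" "j' < k'"
    and eq: "(axis j 1 + axis k 1 :: real ^ 'n::{finite,linorder}) = axis j' 1 + axis k' 1"
  have "(axis j 1 + axis k 1 :: real ^ 'n::{finite,linorder}) $ i = (axis j' 1 + axis k' 1 :: real ^ 'n::{finite,linorder}) $ i" for i
    using eq by simp
  from this[of j] this[of k] show "j = j' \<and> k = k'"
    using lt by (auto simp: axis_def split: if_splits)
qed

text \<open>For each pair \<open>j < k\<close> the two short coroots add up to
  \<open>2 *\<^sub>R axis j 1\<close>, so only the smaller index survives; the long root at
  \<open>j\<close> contributes the remaining 1.\<close>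

lemma sum_coroots_C:
  "(\<Sum>\<alpha>\<in>(pos_roots_C :: (real ^ 'n::{finite,linorder}) set). coroot \<alpha>) =
     (\<chi> j. 1 + 2 * real (card {j<..}))"
  (is "_ = ?v")
proof -
  define S where "S = {(j, k :: 'n). j < k}"
  define L where "L = range (\<lambda>j. 2 *\<^sub>R axis j 1 :: real ^ 'n::{finite,linorder})"
  define D where "D = (\<lambda>(j, k). axis j 1 - axis k 1 :: real ^ 'n::{finite,linorder}) ` S"
  define P where "P = (\<lambda>(j, k). axis j 1 + axis k 1 :: real ^ 'n::{finite,linorder}) ` S"
  have roots: "pos_roots_C = L \<union> D \<union> P"
    unfolding pos_roots_C_def L_def D_def P_def S_def by (simp add: image_def) blast
  \<comment> \<open>The three families must be disjoint for the sum to split: squared length 4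
    against 2 separates \<open>L\<close> from the others, and a negative coordinate separates
    \<open>D\<close> from \<open>P\<close>.\<close>
  have normL: "(norm x)\<^sup>2 = 4" if "x \<in> L" for x
    using that by (auto simp: L_def)
  have normDP: "(norm x)\<^sup>2 = 2" if "x \<in> D \<union> P" for x
    using that by (auto simp: D_def P_def S_def norm_axis_diff_sum_sq)
  have "L \<inter> (D \<union> P) = {}"
  proof (rule ccontr)
    assume "\<not> ?thesis"
    then obtain x where "x \<in> L" "x \<in> D \<union> P" by blast
    then show False using normL[of x] normDP[of x] by simp
  qed
  moreover have "D \<inter> P = {}"
  proof -
    have False if "x \<in> D" "x \<in> P" for x
    proof -
      have "\<exists>i. x $ i < 0"
        using that(1) by (force simp: D_def S_def axis_def)
      moreover have "\<forall>i. x $ i \<ge> 0"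
        using that(2) by (auto simp: P_def S_def axis_def)
      ultimately show False by (meson not_less)
    qed
    then show ?thesis by blast
  qed
  moreover have "finite L" "finite D" "finite P"
    by (simp_all add: L_def D_def P_def)
  ultimately have "(\<Sum>\<alpha>\<in>pos_roots_C. coroot \<alpha>)
      = (\<Sum>\<alpha>\<in>L. coroot \<alpha>) + (\<Sum>\<alpha>\<in>D. coroot \<alpha>) + (\<Sum>\<alpha>\<in>P. coroot \<alpha>)"
    unfolding roots by (simp add: sum.union_disjoint Int_Un_distrib Int_Un_distrib2)
  moreover have "(\<Sum>\<alpha>\<in>L. coroot \<alpha>) = (\<Sum>j\<in>UNIV. axis j 1)"
  proof -
    have "inj (\<lambda>j. 2 *\<^sub>R axis j 1 :: real ^ 'n::{finite,linorder})"
      by (rule injI) (simp add: axis_eq_axis)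
    then show ?thesis
      unfolding L_def by (simp add: sum.reindex coroot_long_C)
  qed
  moreover have "(\<Sum>\<alpha>\<in>D. coroot \<alpha>) = (\<Sum>(j, k)\<in>S. axis j 1 - axis k 1)"
    unfolding D_def using inj_on_axis_diff
    by (subst sum.reindex) (auto simp: S_def coroot_short_C intro!: sum.cong)
  moreover have "(\<Sum>\<alpha>\<in>P. coroot \<alpha>) = (\<Sum>(j, k)\<in>S. axis j 1 + axis k 1)"
    unfolding P_def using inj_on_axis_add
    by (subst sum.reindex) (auto simp: S_def coroot_short_C intro!: sum.cong)
  ultimately have "(\<Sum>\<alpha>\<in>pos_roots_C. coroot \<alpha>)
      = (\<Sum>j\<in>UNIV. axis j 1) + (\<Sum>(j, k)\<in>S. 2 *\<^sub>R axis j 1)"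
    by (simp add: add.assoc flip: sum.distrib) (simp add: case_prod_unfold scaleR_2)
  also have "\<dots> = ?v"
  proof (rule vec_eq_iff[THEN iffD2], rule allI)
    fix i :: 'n
    have "(\<Sum>(j, k)\<in>S. 2 *\<^sub>R axis j 1 :: real ^ 'n::{finite,linorder}) $ i = (\<Sum>p\<in>S. if fst p = i then 2 else 0)"
      by (auto simp: case_prod_unfold axis_def intro!: sum.cong)
    \<comment> \<open>Coordinate \<open>i\<close> counts the pairs starting at \<open>i\<close>, one
      for each later index.\<close>
    also have "\<dots> = (\<Sum>p\<in>{p \<in> S. fst p = i}. 2)"
      by (rule sum.inter_filter[symmetric]) simp
    also have "{p \<in> S. fst p = i} = Pair i ` {i<..}"
      by (auto simp: S_def)
    also have "(\<Sum>p\<in>Pair i ` {i<..}. 2) = 2 * real (card {i<..})"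
      by (simp add: card_image inj_on_def)
    finally have "(\<Sum>(j, k)\<in>S. 2 *\<^sub>R axis j 1 :: real ^ 'n::{finite,linorder}) $ i = 2 * real (card {i<..})" .
    moreover have "(\<Sum>j\<in>UNIV. axis j 1 :: real ^ 'n::{finite,linorder}) $ i = 1"
      by (simp add: axis_def)
    ultimately show "((\<Sum>j\<in>UNIV. axis j 1) + (\<Sum>(j, k)\<in>S. 2 *\<^sub>R axis j 1)) $ i = ?v $ i"
      by simp
  qed
  finally show ?thesis .
qed

lemma dual_weyl_vector_C_nth:
  "dual_weyl_vector_C $ j = real (card {j<..}) + 1/2"
  by (simp add: dual_weyl_vector_C_def sum_coroots_C field_simps)

lemma card_greaterThan_less:
  fixes j k :: "'n::{finite,linorder}"
  assumes "j < k"
  shows "card {k<..} < card {j<..}"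
  using assms by (intro psubset_card_mono) auto

text \<open>The critical roots are the differences: they take the value
  \<open>card {j<..} - card {k<..}\<close>, a positive integer.\<close>

lemma one_le_pos_root_dual_weyl_vector_C:
  assumes "\<alpha> \<in> pos_roots_C"
  shows "1 \<le> \<alpha> \<bullet> dual_weyl_vector_C"
  using assms card_greaterThan_less
  by (fastforce simp: pos_roots_C_def inner_axis' inner_diff_left inner_add_left
      dual_weyl_vector_C_nth)

lemma le_root_margin_iff:
  "c \<le> root_margin r \<longleftrightarrow> (\<forall>\<alpha>\<in>pos_roots_C. c \<le> \<alpha> \<bullet> r)"
  by (simp add: root_margin_def finite_pos_roots_C pos_roots_C_nonempty)

text \<open>The long root at the last index gives \<open>c / 2 \<le> r $ j\<close>, and each step to
  the preceding index gains at least \<open>c\<close>, while the dual Weyl vector gains exactly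
  1.\<close>

lemma root_margin_dominates:
  fixes r :: "real ^ 'n::{finite,linorder}"
  assumes "c \<le> root_margin r"
  shows "c * dual_weyl_vector_C $ j \<le> r $ j"
proof (induction "card {j<..}" arbitrary: j)
  case 0
  have "(2 *\<^sub>R axis j 1 :: real ^ 'n::{finite,linorder}) \<in> pos_roots_C"
    unfolding pos_roots_C_def by blast
  then have "c \<le> (2 *\<^sub>R axis j 1) \<bullet> r"
    using assms le_root_margin_iff by blast
  then show ?case
    using 0 by (simp add: dual_weyl_vector_C_nth inner_axis')
next
  case (Suc d)
  \<comment> \<open>The immediate successor of \<open>j\<close>: the count of later indices drops by
    exactly one, as the induction requires.\<close>
  define k where "k = Min {j<..}"
  have ne: "{j<..} \<noteq> {}"
    using Suc.hyps(2) by (metis card.empty nat.distinct(1))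
  have "j < k"
    using Min_in[OF _ ne] by (simp add: k_def)
  moreover have "{j<..} = insert k {k<..}"
    using \<open>j < k\<close> Min_le[of "{j<..}"] by (fastforce simp: k_def order.order_iff_strict)
  ultimately have card: "card {j<..} = Suc (card {k<..})"
    by simp
  have "(axis j 1 - axis k 1 :: real ^ 'n::{finite,linorder}) \<in> pos_roots_C"
    unfolding pos_roots_C_def using \<open>j < k\<close> by blast
  then have "c \<le> (axis j 1 - axis k 1) \<bullet> r"
    using assms le_root_margin_iff by blast
  then have "c + r $ k \<le> r $ j"
    by (simp add: inner_diff_left inner_axis')
  moreover have "c * dual_weyl_vector_C $ k \<le> r $ k"
    using Suc card by simp
  ultimately show ?case
    by (simp add: dual_weyl_vector_C_nth card algebra_simps)
qed

text \<open>With equal norms, the squared distance is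
  \<open>2 * (v \<bullet> v - u \<bullet> v)\<close>, and domination makes this nonpositive.\<close>

lemma eq_if_dominates_norm_eq:
  fixes u v :: "real ^ 'n"
  assumes "\<And>i. 0 \<le> v $ i" "\<And>i. v $ i \<le> u $ i" "norm u = norm v"
  shows "u = v"
proof -
  have "v \<bullet> v \<le> u \<bullet> v"
    unfolding inner_vec_def using assms by (auto intro!: sum_mono mult_right_mono)
  moreover have "u \<bullet> u = v \<bullet> v"
    using assms(3) by (simp add: norm_eq)
  ultimately have "(u - v) \<bullet> (u - v) \<le> 0"
    by (simp add: inner_diff_left inner_diff_right inner_commute)
  then show ?thesis by (metis inner_ge_zero inner_eq_zero_iff order_antisym right_minus_eq)
qed

theorem theoremS18:
  shows "(dual_weyl_vector_C :: real ^ 'n::{finite,linorder}) =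
           (1/2) *\<^sub>R (\<chi> j. 2 * real CARD('n::{finite,linorder}) - 2 * real (index_pos j) + 1)
       \<and> (\<forall>r :: real ^ 'n::{finite,linorder}.
             is_arg_max root_margin (\<lambda>r. r \<in> closed_chamber_C \<and> norm r = 1) r \<longleftrightarrow>
             r = dual_weyl_vector_C /\<^sub>R norm (dual_weyl_vector_C :: real ^ 'n::{finite,linorder}))"
proof -
  define \<rho> where "\<rho> = (dual_weyl_vector_C :: real ^ 'n::{finite,linorder})"
  define s where "s = \<rho> /\<^sub>R norm \<rho>"
  have formula: "\<rho> = (1/2) *\<^sub>R (\<chi> j. 2 * real CARD('n) - 2 * real (index_pos j) + 1)"
  proof (rule vec_eq_iff[THEN iffD2], rule allI)
    fix i :: 'n
    have "real CARD('n) = real (index_pos i) + real (card {i<..})"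
      using index_pos_add_card_greaterThan[of i] by linarith
    then show "\<rho> $ i =
        ((1/2) *\<^sub>R (\<chi> j. 2 * real CARD('n) - 2 * real (index_pos j) + 1)) $ i"
      by (simp add: \<rho>_def dual_weyl_vector_C_nth)
  qed
  have \<rho>_pos: "0 < \<rho> $ i" for i
    by (simp add: \<rho>_def dual_weyl_vector_C_nth add_nonneg_pos)
  then have "\<rho> \<noteq> 0"
    by (metis less_irrefl zero_index)
  then have norm_s: "norm s = 1"
    by (simp add: s_def)
  have s_nonneg: "0 \<le> s $ i" for i
    using \<rho>_pos[of i] by (simp add: s_def)
  have "s $ k \<le> s $ j" if "j \<le> k" for j k
  proof -
    have "card {k<..} \<le> card {j<..}"
      using that by (intro card_mono) auto
    then show ?thesis
      by (simp add: s_def \<rho>_def dual_weyl_vector_C_nth mult_left_mono)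
  qed
  then have s_feasible: "s \<in> closed_chamber_C"
    using s_nonneg by (simp add: closed_chamber_C_def)
  have margin_s: "inverse (norm \<rho>) \<le> root_margin s"
    using one_le_pos_root_dual_weyl_vector_C
    by (auto simp: le_root_margin_iff s_def \<rho>_def mult_le_cancel_left1)
  \<comment> \<open>By \<open>margin_s\<close>, domination applies with
    \<open>c = inverse (norm \<rho>)\<close>, for which \<open>c\<close> times \<open>\<rho>\<close>
    is \<open>s\<close>.\<close>
  have unique: "r = s" if "norm r = 1" "root_margin s \<le> root_margin r" for r
  proof (rule eq_if_dominates_norm_eq)
    show "s $ i \<le> r $ i" for i
      using root_margin_dominates[of "inverse (norm \<rho>)" r i] margin_s that(2)
      by (simp add: s_def \<rho>_def)
  qed (use s_nonneg norm_s that in auto)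
  \<comment> \<open>By \<open>unique\<close>, every other unit vector has strictly smaller margin
    than \<open>s\<close>, which yields existence and uniqueness of the maximizer together.\<close>
  have "is_arg_max root_margin (\<lambda>r. r \<in> closed_chamber_C \<and> norm r = 1) r \<longleftrightarrow> r = s" for r
    unfolding is_arg_max_def using unique s_feasible norm_s
    by (metis less_imp_le less_irrefl not_less)
  then show ?thesis
    using formula unfolding s_def \<rho>_def by blast
qed

end
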